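(* Let $\mathbb{A}$ be a unital $C^*$-algebra, let $(X,\mathbb{A},d)$ be a complete $C^*$-algebra valued metric space, let $\varphi: X\to\mathbb{A}_+$ be a function, let $F\in\mathcal{F}$, and let $T:X\to X$. Suppose that: (a) $\varphi$ is lower semi-continuous; (b) $T$ is an $(F,\varphi)$-contraction with respect to $d$, i.e. there is a real number $k\in(0,1)$ such that $$F(d(Tx,Ty),\varphi(Tx),\varphi(Ty))\preceq k\,F(d(x,y),\varphi(x),\varphi(y))\quad\text{for all }x,y\in X.$$ Then: (i) $F_T\subseteq Z_\varphi$; (ii) $T$ is a $\varphi$-Picard operator; (iii) for all $x\in X$ and all $n\in\mathbb{N}$, $$d(T^n x,z)\preceq \frac{k^n}{1-k}\,F(d(Tx,x),\varphi(Tx),\varphi(x)),$$ where $\{z\}=F_T\cap Z_\varphi=F_T$.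
   Context: $\mathbb{A}$ is a unital $C^*$-algebra with zero element $\theta$; $\mathbb{A}_+$ is the set of positive elements (self-adjoint with spectrum in $[0,\infty)$), and for self-adjoint $a,b$, $a\preceq b$ means $b-a\in\mathbb{A}_+$. A $C^*$-algebra valued metric space $(X,\mathbb{A},d)$ is a non-empty set $X$ with $d:X\times X\to\mathbb{A}$ such that for all $x,y,z$: $\theta\preceq d(x,y)$, with $d(x,y)=\theta$ iff $x=y$; $d(x,y)=d(y,x)$; $d(x,y)\preceq d(x,z)+d(z,y)$. Convergence $x_n\to x$ means $\|d(x_n,x)\|\to0$; $(x_n)$ is Cauchy if $\|d(x_n,x_m)\|\to 0$ as $n,m\to\infty$; the space is complete if every Cauchy sequence converges. $\mathcal{F}$ is the set of functions $F:\mathbb{A}_+^3\to\mathbb{A}_+$ such that (F1) $\max\{x,y\}\preceq F(x,y,z)$ for all $x,y,z\in\mathbb{A}_+$, meaning $x\preceq F(x,y,z)$ and $y\preceq F(x,y,z)$; (F2) $F(\theta,\theta,\theta)=\theta$; (F3) $F$ is (norm) continuous. $\varphi:X\to\mathbb{A}_+$ is lower semi-continuous if $x_n\to x$ in $X$ implies $\|\varphi(x)\|\le\liminf_n\|\varphi(x_n)\|$. $T^0$ is the identity of $X$ and $T^{n+1}=T\circ T^n$. $F_T=\{x\in X: Tx=x\}$ and $Z_\varphi=\{x\in X:\varphi(x)=\theta\}$. A $\varphi$-fixed point of $T$ is an element of $F_T\cap Z_\varphi$. $T$ is a $\varphi$-Picard operator if $F_T\cap Z_\varphi=\{z\}$ for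 some $z\in X$ and $T^n x\to z$ as $n\to\infty$ for every $x\in X$. *)

theory Defs
  imports "HOL-Analysis.Analysis"
begin

text \<open>
  The library only has real normed algebras, so a unital \<open>C\<^sup>*\<close>-algebra is a real one carrying
  in addition a complex scalar multiplication that extends the real one, and an involution.
\<close>

class cstar_algebra = real_normed_algebra_1 + banach +
  fixes scaleC :: "complex \<Rightarrow> 'a \<Rightarrow> 'a"  (infixr \<open>*\<^sub>C\<close> 75)
    and star :: "'a \<Rightarrow> 'a"
  assumes scaleC_add_right: "c *\<^sub>C (a + b) = c *\<^sub>C a + c *\<^sub>C b"
    and scaleC_add_left: "(c + c') *\<^sub>C a = c *\<^sub>C a + c' *\<^sub>C a"
    and scaleC_scaleC: "c *\<^sub>C (c' *\<^sub>C a) = (c * c') *\<^sub>C a"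
    and scaleC_complex_of_real: "complex_of_real r *\<^sub>C a = r *\<^sub>R a"
    and mult_scaleC_left: "(c *\<^sub>C a) * b = c *\<^sub>C (a * b)"
    and mult_scaleC_right: "a * (c *\<^sub>C b) = c *\<^sub>C (a * b)"
    and norm_scaleC: "norm (c *\<^sub>C a) = cmod c * norm a"
    and star_star: "star (star a) = a"
    and star_add: "star (a + b) = star a + star b"
    and star_scaleC: "star (c *\<^sub>C a) = cnj c *\<^sub>C star a"
    and star_mult: "star (a * b) = star b * star a"
    and cstar_identity: "norm (star a * a) = (norm a)\<^sup>2"

definition self_adjoint :: "'a::cstar_algebra \<Rightarrow> bool" where
  "self_adjoint a \<longleftrightarrow> star a = a"

definition spectrum :: "'a::cstar_algebra \<Rightarrow> complex set" where
  "spectrum a = {l. \<not> (\<exists>b. (l *\<^sub>C 1 - a) * b = 1 \<and> b * (l *\<^sub>C 1 - a) = 1)}"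

definition pos_cone :: "'a::cstar_algebra set" where
  "pos_cone = {a. self_adjoint a \<and> spectrum a \<subseteq> complex_of_real ` {0..}}"

definition cstar_le :: "'a::cstar_algebra \<Rightarrow> 'a \<Rightarrow> bool"  (infix \<open>\<preceq>\<close> 50) where
  "a \<preceq> b \<longleftrightarrow> self_adjoint a \<and> self_adjoint b \<and> b - a \<in> pos_cone"

text \<open>
  Spaces are given by an explicit carrier, as in the library's locale \<open>Metric_space\<close>; functions
  on the carrier (or on the positive cone) are only constrained there.
\<close>

locale cstar_metric_space =
  fixes X :: "'x set" and d :: "'x \<Rightarrow> 'x \<Rightarrow> 'a::cstar_algebra"
  assumes nonempty: "X \<noteq> {}"
    and nonneg: "x \<in> X \<Longrightarrow> y \<in> X \<Longrightarrow> 0 \<preceq> d x y"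
    and zero_iff: "x \<in> X \<Longrightarrow> y \<in> X \<Longrightarrow> d x y = 0 \<longleftrightarrow> x = y"
    and commute: "x \<in> X \<Longrightarrow> y \<in> X \<Longrightarrow> d x y = d y x"
    and triangle: "x \<in> X \<Longrightarrow> y \<in> X \<Longrightarrow> z \<in> X \<Longrightarrow> d x y \<preceq> d x z + d z y"

definition cstar_converges ::
  "('x \<Rightarrow> 'x \<Rightarrow> 'a::cstar_algebra) \<Rightarrow> (nat \<Rightarrow> 'x) \<Rightarrow> 'x \<Rightarrow> bool" where
  "cstar_converges d s x \<longleftrightarrow> (\<lambda>n. norm (d (s n) x)) \<longlonglongrightarrow> 0"

definition cstar_Cauchy :: "('x \<Rightarrow> 'x \<Rightarrow> 'a::cstar_algebra) \<Rightarrow> (nat \<Rightarrow> 'x) \<Rightarrow> bool" where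
  "cstar_Cauchy d s \<longleftrightarrow> (\<forall>e>0. \<exists>N. \<forall>n\<ge>N. \<forall>m\<ge>N. norm (d (s n) (s m)) < e)"

definition cstar_complete :: "'x set \<Rightarrow> ('x \<Rightarrow> 'x \<Rightarrow> 'a::cstar_algebra) \<Rightarrow> bool" where
  "cstar_complete X d \<longleftrightarrow>
    (\<forall>s. range s \<subseteq> X \<longrightarrow> cstar_Cauchy d s \<longrightarrow> (\<exists>x\<in>X. cstar_converges d s x))"

definition class_F :: "('a::cstar_algebra \<Rightarrow> 'a \<Rightarrow> 'a \<Rightarrow> 'a) set" where
  "class_F = {F.
    (\<forall>x\<in>pos_cone. \<forall>y\<in>pos_cone. \<forall>z\<in>pos_cone. F x y z \<in> pos_cone) \<and>
    (\<forall>x\<in>pos_cone. \<forall>y\<in>pos_cone. \<forall>z\<in>pos_cone. x \<preceq> F x y z \<and> y \<preceq> F x y z) \<and>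
    F 0 0 0 = 0 \<and>
    continuous_on (pos_cone \<times> pos_cone \<times> pos_cone) (\<lambda>(x, y, z). F x y z)}"

text \<open>The limit inferior is taken in the extended reals, as the norms may be unbounded.\<close>

definition cstar_lsc ::
  "'x set \<Rightarrow> ('x \<Rightarrow> 'x \<Rightarrow> 'a::cstar_algebra) \<Rightarrow> ('x \<Rightarrow> 'a) \<Rightarrow> bool" where
  "cstar_lsc X d \<phi> \<longleftrightarrow>
    (\<forall>s x. range s \<subseteq> X \<longrightarrow> x \<in> X \<longrightarrow> cstar_converges d s x \<longrightarrow>
      ereal (norm (\<phi> x)) \<le> liminf (\<lambda>n. ereal (norm (\<phi> (s n)))))"

definition fixed_points :: "'x set \<Rightarrow> ('x \<Rightarrow> 'x) \<Rightarrow> 'x set" where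
  "fixed_points X T = {x \<in> X. T x = x}"

definition zero_set :: "'x set \<Rightarrow> ('x \<Rightarrow> 'a::cstar_algebra) \<Rightarrow> 'x set" where
  "zero_set X \<phi> = {x \<in> X. \<phi> x = 0}"

definition phi_Picard_operator ::
  "'x set \<Rightarrow> ('x \<Rightarrow> 'x \<Rightarrow> 'a::cstar_algebra) \<Rightarrow> ('x \<Rightarrow> 'a) \<Rightarrow> ('x \<Rightarrow> 'x) \<Rightarrow> bool" where
  "phi_Picard_operator X d \<phi> T \<longleftrightarrow>
    (\<exists>z\<in>X. fixed_points X T \<inter> zero_set X \<phi> = {z} \<and>
      (\<forall>x\<in>X. cstar_converges d (\<lambda>n. (T ^^ n) x) z))"

text \<open>The contraction constant is a parameter, since the error estimate refers to it.\<close>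

definition F_phi_contraction_with ::
  "real \<Rightarrow> 'x set \<Rightarrow> ('x \<Rightarrow> 'x \<Rightarrow> 'a::cstar_algebra) \<Rightarrow> ('a \<Rightarrow> 'a \<Rightarrow> 'a \<Rightarrow> 'a) \<Rightarrow>
    ('x \<Rightarrow> 'a) \<Rightarrow> ('x \<Rightarrow> 'x) \<Rightarrow> bool" where
  "F_phi_contraction_with k X d F \<phi> T \<longleftrightarrow> 0 < k \<and> k < 1 \<and>
    (\<forall>x\<in>X. \<forall>y\<in>X. F (d (T x) (T y)) (\<phi> (T x)) (\<phi> (T y)) \<preceq> k *\<^sub>R F (d x y) (\<phi> x) (\<phi> y))"

end

theory Submission
  imports Defs
begin

text \<open>
  The metric half is the classical Picard argument. Write \<open>gap x = F (d (T x) x) (\<phi> (T x)) (\<phi> x)\<close>.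
  The contraction applied to consecutive iterates gives \<open>gap (T\<^sup>n x) \<preceq> k\<^sup>n gap x\<close>, and since \<open>F\<close>
  dominates its first two arguments, the steps \<open>d (T\<^sup>n\<^sup>+\<^sup>1 x) (T\<^sup>n x)\<close> and the values
  \<open>\<phi> (T\<^sup>n\<^sup>+\<^sup>1 x)\<close> are both dominated by that geometric sequence. So the orbit is Cauchy and
  \<open>\<phi>\<close> tends to zero along it; lower semicontinuity forces \<open>\<phi> z = 0\<close> at the limit \<open>z\<close>. The
  contraction between \<open>T\<^sup>n x\<close> and \<open>z\<close>, with continuity of \<open>F\<close> at the origin and
  \<open>F 0 0 0 = 0\<close>, then shows \<open>T\<^sup>n\<^sup>+\<^sup>1 x \<rightarrow> T z\<close>, hence \<open>T z = z\<close>. For two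
  fixed points, the value of \<open>F\<close> is at most \<open>k\<close> times itself, so it vanishes; this gives uniqueness
  and also that \<open>\<phi>\<close> vanishes at every fixed point.

  This argument needs the following about the order of a \<open>C\<^sup>*\<close>-algebra: positive elements form a norm
  closed convex cone, and the norm is monotone on it. All of that follows from the criterion that
  a self-adjoint \<open>a\<close> with \<open>norm a \<le> t\<close> is positive exactly when \<open>norm (t - a) \<le> t\<close>
  (\<open>pos_cone_if_norm_le\<close>, \<open>pos_cone_norm_le\<close>), because the norm inequality visibly survives sums,
  scaling and limits. The criterion in turn rests on two facts about a self-adjoint element: its
  spectrum is real, and one of \<open>norm a\<close>, \<open>- norm a\<close> lies in the spectrum (\<open>norm_in_spectrum\<close>).

  The second fact is usually obtained from the spectral radius formula; here it follows from
  square roots alone. Let \<open>norm a \<le> 1\<close> and let \<open>1 - a\<^sup>2\<close> be invertible. Its square root \<open>h\<close>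
  is then invertible too, so \<open>1 - a\<^sup>2 = h\<^sup>2\<close> remains a square \<open>b\<^sup>2\<close> after a small positive
  \<open>\<epsilon>\<close> is subtracted. From \<open>a\<^sup>2 + b\<^sup>2 = 1 - \<epsilon>\<close> the \<open>C\<^sup>*\<close>-identity for \<open>a + \<i> b\<close>
  gives \<open>norm a < 1\<close>. Thus if \<open>norm a = 1\<close>, one of \<open>1 - a\<close> and \<open>1 + a\<close> is not invertible.
\<close>

section \<open>Scalars, involution and inverses\<close>

lemma scaleC_one: "1 *\<^sub>C (a::'a::cstar_algebra) = a"
  using scaleC_complex_of_real[of 1 a] by simp

lemma scaleC_minus_left: "(- c) *\<^sub>C (a::'a::cstar_algebra) = - (c *\<^sub>C a)"
proof -
  have "(- c) *\<^sub>C a = (complex_of_real (-1) * c) *\<^sub>C a" by simp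
  also have "\<dots> = (-1) *\<^sub>R (c *\<^sub>C a)"
    by (metis scaleC_scaleC scaleC_complex_of_real)
  finally show ?thesis by simp
qed

lemma scaleC_minus_right: "c *\<^sub>C (- (a::'a::cstar_algebra)) = - (c *\<^sub>C a)"
proof -
  have "c *\<^sub>C (- a) + c *\<^sub>C a = c *\<^sub>C (0::'a)" by (metis scaleC_add_right add.left_inverse)
  moreover have "c *\<^sub>C (0::'a) = 0" using norm_scaleC[of c "0::'a"] by simp
  ultimately show ?thesis by (simp add: eq_neg_iff_add_eq_0)
qed

lemma scaleC_diff_right: "c *\<^sub>C (a - b) = c *\<^sub>C a - c *\<^sub>C (b::'a::cstar_algebra)"
  using scaleC_add_right[of c a "- b"] by (simp add: scaleC_minus_right)

lemma star_scaleR: "star (r *\<^sub>R a) = r *\<^sub>R star (a::'a::cstar_algebra)"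
  by (metis star_scaleC scaleC_complex_of_real complex_cnj_complex_of_real)

lemma star_zero: "star 0 = (0::'a::cstar_algebra)"
  using star_scaleR[of 0 "0::'a"] by simp

lemma star_minus: "star (- a) = - star (a::'a::cstar_algebra)"
  using star_scaleR[of "-1" a] by simp

lemma star_diff: "star (a - b) = star a - star (b::'a::cstar_algebra)"
  using star_add[of a "- b"] by (simp add: star_minus)

lemma star_one: "star 1 = (1::'a::cstar_algebra)"
  by (metis mult.right_neutral mult.left_neutral star_mult star_star)

lemma norm_star: "norm (star a) = norm (a::'a::cstar_algebra)"
proof -
  have le: "norm b \<le> norm (star b)" for b :: 'a
  proof (cases "b = 0")
    case False
    have "norm b * norm b \<le> norm (star b) * norm b"
      using norm_mult_ineq[of "star b" b] cstar_identity[of b] by (simp add: power2_eq_square)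
    then show ?thesis using False by simp
  qed simp
  show ?thesis using le[of a] le[of "star a"] by (simp add: star_star)
qed

lemma bounded_linear_star: "bounded_linear (star :: 'a::cstar_algebra \<Rightarrow> 'a)"
  by (rule bounded_linear_intro[where K=1]) (simp_all add: star_add star_scaleR norm_star)

lemma self_adjoint_simps:
  fixes a b :: "'a::cstar_algebra"
  shows "self_adjoint (0::'a)" "self_adjoint (1::'a)"
    and "self_adjoint a \<Longrightarrow> self_adjoint b \<Longrightarrow> self_adjoint (a + b)"
    and "self_adjoint a \<Longrightarrow> self_adjoint b \<Longrightarrow> self_adjoint (a - b)"
    and "self_adjoint a \<Longrightarrow> self_adjoint (r *\<^sub>R a)"
    and "self_adjoint a \<Longrightarrow> self_adjoint (a * a)"
  by (simp_all add: self_adjoint_def star_zero star_one star_add star_diff star_scaleR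
      star_mult)

lemma self_adjoint_limit:
  fixes s :: "nat \<Rightarrow> 'a::cstar_algebra"
  assumes "s \<longlonglongrightarrow> l" "\<And>n. self_adjoint (s n)"
  shows "self_adjoint l"
proof -
  have "(\<lambda>n. star (s n)) \<longlonglongrightarrow> star l" using bounded_linear_star assms(1) by (rule bounded_linear.tendsto)
  then have "s \<longlonglongrightarrow> star l" using assms(2) by (simp add: self_adjoint_def)
  then show ?thesis using assms(1) LIMSEQ_unique by (auto simp: self_adjoint_def)
qed

lemma norm_square_self_adjoint:
  "self_adjoint (a::'a::cstar_algebra) \<Longrightarrow> norm (a * a) = (norm a)\<^sup>2"
  using cstar_identity[of a] by (simp add: self_adjoint_def)

definition two_sided_inverse :: "'a::cstar_algebra \<Rightarrow> 'a \<Rightarrow> bool" where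
  "two_sided_inverse a b \<longleftrightarrow> a * b = 1 \<and> b * a = 1"

lemma spectrum_iff: "l \<in> spectrum a \<longleftrightarrow> \<not> (\<exists>b. two_sided_inverse (l *\<^sub>C 1 - a) b)"
  by (simp add: spectrum_def two_sided_inverse_def)

lemma two_sided_inverse_scaleC:
  assumes "two_sided_inverse a b" "c \<noteq> 0"
  shows "two_sided_inverse (c *\<^sub>C a) ((1 / c) *\<^sub>C b)"
  using assms by (simp add: two_sided_inverse_def mult_scaleC_left mult_scaleC_right scaleC_scaleC
      scaleC_one)

lemma inverse_commutes:
  assumes "two_sided_inverse a b" "x * a = a * x"
  shows "x * b = b * x"
proof -
  have "x * b = b * (a * x) * b" using assms(1)
    by (metis mult.assoc mult.left_neutral two_sided_inverse_def)
  also have "\<dots> = b * x * (a * b)" using assms(2) by (metis mult.assoc)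
  finally show ?thesis using assms(1) by (simp add: two_sided_inverse_def)
qed

text \<open>
  A right inverse is a fixed point of \<open>b \<mapsto> 1 + x b\<close> and a left inverse one of \<open>b \<mapsto> 1 + b x\<close>. Both
  maps are contractions, which replaces summing the Neumann series.
\<close>

lemma neumann_inverse:
  fixes x :: "'a::cstar_algebra"
  assumes "norm x < 1"
  shows "\<exists>b. two_sided_inverse (1 - x) b"
proof -
  have ex_fixpoint: "\<exists>b. f b = b" if "\<And>u v. dist (f u) (f v) \<le> norm x * dist u v" for f :: "'a \<Rightarrow> 'a"
    using banach_fix_type[of "norm x" f] assms that by auto
  have "dist (1 + x * u) (1 + x * v) \<le> norm x * dist u v" for u v
    using norm_mult_ineq[of x "u - v"] by (simp add: dist_norm right_diff_distrib)
  from ex_fixpoint[OF this] obtain b where b: "1 + x * b = b" by blast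
  have "dist (1 + u * x) (1 + v * x) \<le> norm x * dist u v" for u v
    using norm_mult_ineq[of "u - v" x] by (simp add: dist_norm left_diff_distrib mult.commute)
  from ex_fixpoint[OF this] obtain b' where b': "1 + b' * x = b'" by blast
  have 1: "(1 - x) * b = 1" using b by (simp add: left_diff_distrib diff_eq_eq)
  have 2: "b' * (1 - x) = 1" using b' by (simp add: right_diff_distrib diff_eq_eq)
  have "b' = b" using 1 2 by (metis mult.assoc mult.left_neutral mult.right_neutral)
  with 1 2 show ?thesis by (auto simp: two_sided_inverse_def)
qed

section \<open>The spectrum of a self-adjoint element\<close>

lemma spectrum_norm_bound:
  fixes a :: "'a::cstar_algebra"
  assumes "l \<in> spectrum a"
  shows "cmod l \<le> norm a"
proof (rule ccontr)
  assume "\<not> ?thesis"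
  then have less: "norm a < cmod l" by simp
  then have l: "l \<noteq> 0" using norm_ge_zero[of a] by force
  have "norm ((1 / l) *\<^sub>C a) < 1" using less l by (simp add: norm_scaleC norm_divide)
  then obtain b where "two_sided_inverse (1 - (1 / l) *\<^sub>C a) b" using neumann_inverse by blast
  from two_sided_inverse_scaleC[OF this l]
  have "two_sided_inverse (l *\<^sub>C 1 - a) ((1 / l) *\<^sub>C b)"
    using l by (simp add: scaleC_diff_right scaleC_scaleC scaleC_one)
  with assms show False by (auto simp: spectrum_iff)
qed

text \<open>
  Shifting \<open>a\<close> by \<open>\<i> s\<close> shifts the imaginary part of \<open>l\<close> by \<open>s\<close>, while by the \<open>C\<^sup>*\<close>-identity
  the squared norm grows by at most \<open>s\<^sup>2\<close>. A nonzero \<open>Im l\<close> would contribute a term linear in \<open>s\<close>,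
  unbounded over the real \<open>s\<close>.
\<close>

lemma spectrum_self_adjoint_real:
  fixes a :: "'a::cstar_algebra"
  assumes sa: "self_adjoint a" and l: "l \<in> spectrum a"
  shows "Im l = 0"
proof -
  have bound: "2 * s * Im l \<le> (norm a)\<^sup>2" for s :: real
  proof -
    define c where "c = \<i> * complex_of_real s"
    define x where "x = a + c *\<^sub>C 1"
    have "(l + c) *\<^sub>C 1 - x = l *\<^sub>C 1 - a" by (simp add: x_def scaleC_add_left)
    then have "l + c \<in> spectrum x" using l by (simp add: spectrum_iff)
    then have "(cmod (l + c))\<^sup>2 \<le> (norm x)\<^sup>2"
      by (intro power_mono spectrum_norm_bound) auto
    also have "\<dots> = norm (star x * x)" by (simp add: cstar_identity)
    also have "star x = a - c *\<^sub>C 1"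
      using sa by (simp add: x_def star_add star_scaleC star_one self_adjoint_def c_def
          scaleC_minus_left)
    also have "(a - c *\<^sub>C 1) * x = a * a - (c * c) *\<^sub>C 1"
      by (simp add: x_def algebra_simps mult_scaleC_left mult_scaleC_right scaleC_scaleC
          scaleC_diff_right)
    also have "c * c = complex_of_real (- (s * s))" by (simp add: c_def complex_eq_iff)
    also have "\<dots> *\<^sub>C 1 = (- (s * s)) *\<^sub>R (1::'a)" by (rule scaleC_complex_of_real)
    also have "norm (a * a - (- (s * s)) *\<^sub>R 1) \<le> norm (a * a) + norm ((s * s) *\<^sub>R (1::'a))"
      using norm_triangle_ineq[of "a * a" "(s * s) *\<^sub>R (1::'a)"] by simp
    also have "\<dots> = (norm a)\<^sup>2 + s\<^sup>2"
      using sa by (simp add: norm_square_self_adjoint power2_eq_square)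
    finally have "(Re l)\<^sup>2 + (Im l + s)\<^sup>2 \<le> (norm a)\<^sup>2 + s\<^sup>2"
      by (simp add: cmod_power2 c_def)
    moreover have "(Im l + s)\<^sup>2 = (Im l)\<^sup>2 + 2 * s * Im l + s\<^sup>2"
      by (simp add: power2_eq_square algebra_simps)
    ultimately show ?thesis using zero_le_power2[of "Re l"] zero_le_power2[of "Im l"] by linarith
  qed
  show ?thesis
  proof (rule ccontr)
    assume ne: "Im l \<noteq> 0"
    \<comment> \<open>Choose \<open>s\<close> so that the linear term equals \<open>(norm a)\<^sup>2 + 1\<close>.\<close>
    have "2 * (((norm a)\<^sup>2 + 1) / (2 * Im l)) * Im l \<le> (norm a)\<^sup>2" by (rule bound)
    with ne show False by simp
  qed
qed

lemma spectrum_self_adjoint_of_real: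
  "self_adjoint a \<Longrightarrow> l \<in> spectrum a \<Longrightarrow> l = complex_of_real (Re l)"
  using spectrum_self_adjoint_real by (simp add: complex_eq_iff)

text \<open>
  With \<open>h = 1 - y\<close> the equation \<open>h\<^sup>2 = 1 - c\<close> reads \<open>y = (c + y\<^sup>2) / 2\<close>, which is solved by iteration
  from \<open>0\<close>. The iterates are polynomials in \<open>c\<close> with nonnegative coefficients, so they are
  majorised by the scalar iterates \<open>t\<close> for \<open>c = 1\<close>. Those increase and stay below \<open>1\<close>, which gives
  convergence even in the boundary case \<open>norm c = 1\<close>, where the iteration is no contraction.
  Being a limit of polynomials in \<open>c\<close>, the root commutes with everything that commutes with \<open>c\<close>.
\<close>

lemma sqrt_one_minus:
  fixes c :: "'a::cstar_algebra"
  assumes c1: "norm c \<le> 1" and sa: "self_adjoint c"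
  obtains h where "self_adjoint h" "h * h = 1 - c" "\<And>x. x * c = c * x \<Longrightarrow> x * h = h * x"
proof -
  define y where "y n = ((\<lambda>u. (1/2) *\<^sub>R (c + u * u)) ^^ n) 0" for n :: nat
  define t where "t n = ((\<lambda>u::real. (1 + u * u) / 2) ^^ n) 0" for n :: nat
  have y0: "y 0 = 0" and yS: "y (Suc n) = (1/2) *\<^sub>R (c + y n * y n)" for n
    by (simp_all add: y_def)
  have t0: "t 0 = 0" and tS: "t (Suc n) = (1 + t n * t n) / 2" for n
    by (simp_all add: t_def)
  have t01: "0 \<le> t n \<and> t n \<le> 1" for n
  proof (induction n)
    case (Suc n)
    then have "t n * t n \<le> 1" by (simp add: mult_le_one)
    with Suc show ?case by (simp add: tS)
  qed (simp add: t0)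
  have t_mono: "t n \<le> t (Suc n)" for n
    using zero_le_power2[of "t n - 1"] by (simp add: tS power2_eq_square algebra_simps)
  have y_comm: "x * y n = y n * x" if "x * c = c * x" for x n
  proof (induction n)
    case (Suc n)
    then have "x * (y n * y n) = (y n * y n) * x" by (metis mult.assoc)
    with that show ?case by (simp add: yS distrib_left distrib_right)
  qed (simp add: y0)
  have yy: "y m * y n = y n * y m" for m n
    using y_comm[of c m] y_comm[of "y m" n] by simp
  have y_t: "norm (y n) \<le> t n" for n
  proof (induction n)
    case (Suc n)
    have "norm (y n * y n) \<le> t n * t n"
      using norm_mult_ineq mult_mono[OF Suc Suc] t01 by (meson norm_ge_zero order_trans)
    then show ?case using norm_triangle_ineq[of c "y n * y n"] c1 by (simp add: yS tS)
  qed (simp add: y0 t0)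
  have step: "norm (y (Suc n) - y n) \<le> t (Suc n) - t n" for n
  proof (induction n)
    case 0
    then show ?case using c1 by (simp add: yS tS y0 t0)
  next
    case (Suc n)
    have "y (Suc (Suc n)) - y (Suc n)
        = (1/2) *\<^sub>R (y (Suc n) * y (Suc n) - y n * y n)"
      unfolding yS[of "Suc n"] using yS[of n] by (simp add: algebra_simps)
    also have "y (Suc n) * y (Suc n) - y n * y n = (y (Suc n) - y n) * (y (Suc n) + y n)"
      using yy[of "Suc n" n] by (simp add: algebra_simps)
    finally have "norm (y (Suc (Suc n)) - y (Suc n))
        = norm ((y (Suc n) - y n) * (y (Suc n) + y n)) / 2" by simp
    also have "\<dots> \<le> (t (Suc n) - t n) * (t (Suc n) + t n) / 2"
    proof -
      have "norm (y (Suc n) + y n) \<le> t (Suc n) + t n"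
        using norm_triangle_ineq[of "y (Suc n)" "y n"] y_t[of n] y_t[of "Suc n"] by simp
      then have "norm (y (Suc n) - y n) * norm (y (Suc n) + y n)
          \<le> (t (Suc n) - t n) * (t (Suc n) + t n)"
        using Suc t_mono[of n] by (intro mult_mono) auto
      then show ?thesis
        using norm_mult_ineq[of "y (Suc n) - y n" "y (Suc n) + y n"] by simp
    qed
    also have "\<dots> = t (Suc (Suc n)) - t (Suc n)"
      unfolding tS[of "Suc n"] using tS[of n] by (simp add: field_simps)
    finally show ?case .
  qed
  have "summable (\<lambda>n. t (Suc n) - t n)"
  proof -
    have "incseq t" using t_mono by (rule incseq_SucI)
    then have "convergent t"
      using t01 by (intro Bseq_mono_convergent BseqI'[of _ 1]) (auto simp: incseq_def)
    then obtain L where "t \<longlonglongrightarrow> L" by (auto simp: convergent_def)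
    then show ?thesis using telescope_sums sums_summable by blast
  qed
  then have "summable (\<lambda>n. y (Suc n) - y n)"
    by (rule summable_comparison_test'[where N=0]) (rule step)
  then obtain L where "(\<lambda>n. y (Suc n) - y n) sums L" by blast
  then have "(\<lambda>n. y n - y 0) \<longlonglongrightarrow> L"
    by (simp add: sums_def sum_lessThan_telescope)
  then have lim: "y \<longlonglongrightarrow> L" by (simp add: y0)
  have "(\<lambda>n. y (Suc n)) \<longlonglongrightarrow> (1/2) *\<^sub>R (c + L * L)"
    unfolding yS by (intro tendsto_intros lim)
  moreover have "(\<lambda>n. y (Suc n)) \<longlonglongrightarrow> L" using lim by (rule LIMSEQ_Suc)
  ultimately have L: "L = (1/2) *\<^sub>R (c + L * L)" using LIMSEQ_unique by blast
  then have "2 *\<^sub>R L = c + L * L" by (metis half_gt_zero_iff scaleR_half_double scaleR_left_commute scaleR_one scaleR_2 scaleR_add_right)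
  then have "(1 - L) * (1 - L) = 1 - c" by (simp add: algebra_simps scaleR_2)
  moreover have "self_adjoint (y n)" for n
    by (induction n) (simp_all add: y0 yS self_adjoint_simps sa)
  then have "self_adjoint (1 - L)"
    using self_adjoint_limit[OF lim] by (simp add: self_adjoint_simps)
  moreover have "x * (1 - L) = (1 - L) * x" if "x * c = c * x" for x
  proof -
    have "(\<lambda>n. x * y n) \<longlonglongrightarrow> x * L" by (intro tendsto_intros lim)
    moreover have "(\<lambda>n. x * y n) \<longlonglongrightarrow> L * x"
      unfolding y_comm[OF that] by (intro tendsto_intros lim)
    ultimately have "x * L = L * x" using LIMSEQ_unique by blast
    then show ?thesis by (simp add: algebra_simps)
  qed
  ultimately show ?thesis using that by blast
qed

text \<open>
  For commuting \<open>a\<close>, \<open>b\<close> the element \<open>u = a + \<i> b\<close> satisfies \<open>u\<^sup>* u = a\<^sup>2 + b\<^sup>2\<close>, so its norm is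
  known from the \<open>C\<^sup>*\<close>-identity, and \<open>a\<close> is the mean of \<open>u\<close> and \<open>u\<^sup>*\<close>. This yields \<open>a\<^sup>2 \<le> r\<close> in norm
  without any use of the order.
\<close>

lemma norm_le_of_sum_of_squares:
  fixes a b :: "'a::cstar_algebra"
  assumes sa: "self_adjoint a" "self_adjoint b" and comm: "a * b = b * a"
    and sum: "a * a + b * b = r *\<^sub>R 1" and r: "0 \<le> r"
  shows "(norm a)\<^sup>2 \<le> r"
proof -
  define u where "u = a + \<i> *\<^sub>C b"
  have su: "star u = a - \<i> *\<^sub>C b"
    using sa by (simp add: u_def star_add star_scaleC self_adjoint_def scaleC_minus_left)
  have "\<i> *\<^sub>C (\<i> *\<^sub>C (b * b)) = - (b * b)"
    by (simp add: scaleC_scaleC scaleC_minus_left scaleC_one)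
  then have "star u * u = r *\<^sub>R 1"
    unfolding su using comm sum
    by (simp add: u_def algebra_simps mult_scaleC_left mult_scaleC_right scaleC_diff_right)
  then have u: "(norm u)\<^sup>2 = r" using cstar_identity[of u] r by simp
  have "2 *\<^sub>R a = u + star u" unfolding su by (simp add: u_def scaleR_2)
  then have "2 * norm a \<le> norm u + norm (star u)"
    using norm_triangle_ineq[of u "star u"] by (metis abs_numeral norm_scaleR)
  then have "norm a \<le> norm u" by (simp add: norm_star)
  then have "(norm a)\<^sup>2 \<le> (norm u)\<^sup>2" by (simp add: power_mono)
  with u show ?thesis by simp
qed

text \<open>
  With \<open>h\<^sup>2 = 1 - a\<^sup>2\<close> and \<open>g\<close> the inverse of \<open>h\<close>, one has
  \<open>h\<^sup>2 - \<epsilon> = h (1 - \<epsilon> g\<^sup>2) h\<close>. For small \<open>\<epsilon>\<close> the middle factor has a square root \<open>p\<close>, so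
  \<open>b = h p\<close> satisfies \<open>a\<^sup>2 + b\<^sup>2 = 1 - \<epsilon>\<close>. All elements involved commute, because square roots and
  inverses commute with whatever commutes with the original element.
\<close>

lemma norm_less_one_if_invertible:
  fixes a :: "'a::cstar_algebra"
  assumes sa: "self_adjoint a" and a1: "norm a \<le> 1" and inv: "two_sided_inverse (1 - a * a) v"
  shows "norm a < 1"
proof -
  have "norm (a * a) \<le> 1" using a1 by (simp add: norm_square_self_adjoint[OF sa] power_le_one)
  then obtain h where h: "self_adjoint h" "h * h = 1 - a * a"
    and hc: "\<And>x. x * (a * a) = (a * a) * x \<Longrightarrow> x * h = h * x"
    using sqrt_one_minus self_adjoint_simps(6)[OF sa] by metis
  have ah: "a * h = h * a" by (rule hc) (simp add: mult.assoc)
  have hv: "h * v = v * h"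
    by (rule inverse_commutes[OF inv]) (simp add: h(2)[symmetric] mult.assoc)
  define g where "g = h * v"
  have hg: "two_sided_inverse h g"
    using inv h(2) hv unfolding two_sided_inverse_def g_def by (metis mult.assoc)
  have "star g * h = 1" using hg h(1)
    by (metis self_adjoint_def star_mult star_one two_sided_inverse_def)
  then have "star g = g" using hg by (metis mult.assoc mult.left_neutral mult.right_neutral two_sided_inverse_def)
  then have g: "self_adjoint g" by (simp add: self_adjoint_def)
  \<comment> \<open>Small enough for \<open>norm (\<epsilon> g\<^sup>2) \<le> 1\<close> and for \<open>0 \<le> 1 - \<epsilon>\<close>.\<close>
  define \<epsilon> where "\<epsilon> = 1 / (1 + (norm g)\<^sup>2)"
  have pos: "0 < 1 + (norm g)\<^sup>2" by (simp add: add_pos_nonneg)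
  have \<epsilon>: "0 < \<epsilon>" "\<epsilon> \<le> 1" using pos by (simp_all add: \<epsilon>_def)
  define c where "c = \<epsilon> *\<^sub>R (g * g)"
  have "norm c = \<epsilon> * (norm g)\<^sup>2" using \<epsilon> by (simp add: c_def norm_square_self_adjoint[OF g])
  also have "\<dots> \<le> 1" using pos by (simp add: \<epsilon>_def)
  finally obtain p where p: "self_adjoint p" "p * p = 1 - c"
    and pc: "\<And>x. x * c = c * x \<Longrightarrow> x * p = p * x"
    using sqrt_one_minus[of c] g by (metis c_def self_adjoint_simps(5,6))
  have comm_c: "x * c = c * x" if "x * g = g * x" for x
    using that unfolding c_def by (metis mult.assoc mult_scaleR_left mult_scaleR_right)
  have hp: "h * p = p * h" using hg by (intro pc comm_c) (simp add: two_sided_inverse_def)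
  have ap: "a * p = p * a" using inverse_commutes[OF hg ah] by (intro pc comm_c)
  define b where "b = h * p"
  have "self_adjoint b" using h(1) p(1) hp by (simp add: b_def self_adjoint_def star_mult)
  moreover have "a * b = b * a" using ah ap unfolding b_def by (metis mult.assoc)
  moreover have "a * a + b * b = (1 - \<epsilon>) *\<^sub>R 1"
  proof -
    have "b * b = (h * h) * (p * p)" using hp unfolding b_def by (metis mult.assoc)
    also have "\<dots> = h * h - \<epsilon> *\<^sub>R (h * (h * g) * g)"
      by (simp add: p(2) c_def right_diff_distrib mult.assoc)
    also have "h * (h * g) * g = 1" using hg by (simp add: two_sided_inverse_def)
    finally show ?thesis by (simp add: h(2) scaleR_left_diff_distrib)
  qed
  ultimately have "(norm a)\<^sup>2 \<le> 1 - \<epsilon>"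
    using norm_le_of_sum_of_squares sa \<epsilon> by (metis diff_ge_0_iff_ge)
  then have "(norm a)\<^sup>2 < 1" using \<epsilon> by simp
  then show ?thesis by (simp add: abs_square_less_1)
qed

text \<open>
  This replaces the spectral radius formula for self-adjoint elements. If both \<open>\<rho> - a\<close> and
  \<open>- \<rho> - a\<close> were invertible for \<open>\<rho> = norm a\<close>, so would be their product, which is a nonzero
  multiple of \<open>1 - (a / \<rho>)\<^sup>2\<close>; but \<open>a / \<rho>\<close> has norm one.
\<close>

lemma norm_in_spectrum:
  fixes a :: "'a::cstar_algebra"
  assumes sa: "self_adjoint a"
  shows "complex_of_real (norm a) \<in> spectrum a \<or> complex_of_real (- norm a) \<in> spectrum a"
proof (rule ccontr)
  assume neg: "\<not> ?thesis"
  define \<rho> where "\<rho> = norm a"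
  obtain u where u: "two_sided_inverse (\<rho> *\<^sub>R 1 - a) u"
    using neg by (auto simp: spectrum_iff \<rho>_def scaleC_complex_of_real)
  obtain w where w: "two_sided_inverse ((- \<rho>) *\<^sub>R 1 - a) w"
    using neg unfolding spectrum_iff \<rho>_def scaleC_complex_of_real by blast
  have \<rho>: "\<rho> > 0"
  proof (rule ccontr)
    assume "\<not> \<rho> > 0"
    then have "a = 0" "\<rho> = 0" by (simp_all add: \<rho>_def)
    with u show False by (simp add: two_sided_inverse_def)
  qed
  define e where "e = (1 / \<rho>) *\<^sub>R a"
  have e: "self_adjoint e" "norm e = 1"
    using sa \<rho> by (simp_all add: e_def self_adjoint_simps) (simp add: \<rho>_def)
  define P where "P = \<rho> *\<^sub>R 1 - a"
  define Q where "Q = (- \<rho>) *\<^sub>R 1 - a"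
  have PQ: "P * Q = - (\<rho> * \<rho>) *\<^sub>R (1 - e * e)"
    using \<rho> by (simp add: P_def Q_def e_def algebra_simps)
  have "two_sided_inverse (P * Q) (w * u)"
    using u w unfolding two_sided_inverse_def P_def[symmetric] Q_def[symmetric]
    by (metis mult.assoc mult.left_neutral)
  from two_sided_inverse_scaleC[OF this, of "complex_of_real (- 1 / (\<rho> * \<rho>))"] \<rho>
  have "\<exists>v. two_sided_inverse (1 - e * e) v"
    unfolding PQ scaleC_complex_of_real by auto
  then show False using norm_less_one_if_invertible e by fastforce
qed

section \<open>The cone of positive elements\<close>

lemma spectrum_reflect:
  fixes a :: "'a::cstar_algebra"
  shows "complex_of_real r \<in> spectrum (t *\<^sub>R 1 - a) \<longleftrightarrow> complex_of_real (t - r) \<in> spectrum a"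
proof -
  have "complex_of_real (t - r) *\<^sub>C 1 - a
      = - (complex_of_real r *\<^sub>C 1 - (t *\<^sub>R 1 - a))"
    unfolding scaleC_complex_of_real by (simp add: algebra_simps)
  moreover have "two_sided_inverse (- x) (- b) \<longleftrightarrow> two_sided_inverse x b" for x b :: 'a
    by (simp add: two_sided_inverse_def)
  ultimately show ?thesis unfolding spectrum_iff by (metis minus_minus)
qed

text \<open>The spectrum of \<open>a\<close> is real and lies in the disc of radius \<open>t\<close> around \<open>t\<close>.\<close>

lemma pos_cone_if_norm_le:
  fixes a :: "'a::cstar_algebra"
  assumes sa: "self_adjoint a" and le: "norm (t *\<^sub>R 1 - a) \<le> t"
  shows "a \<in> pos_cone"
proof -
  have "l \<in> complex_of_real ` {0..}" if l: "l \<in> spectrum a" for l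
  proof -
    have eq: "l = complex_of_real (Re l)" using spectrum_self_adjoint_of_real[OF sa l] .
    then have "complex_of_real (t - Re l) \<in> spectrum (t *\<^sub>R 1 - a)"
      using l spectrum_reflect[of "t - Re l" t a] by simp
    from spectrum_norm_bound[OF this] have "\<bar>t - Re l\<bar> \<le> t" using le by (simp only: norm_of_real)
    then have "0 \<le> Re l" by simp
    with eq show ?thesis by (metis atLeast_iff image_eqI)
  qed
  with sa show ?thesis by (auto simp: pos_cone_def)
qed

lemma pos_coneD:
  assumes "a \<in> pos_cone"
  shows "self_adjoint a" "complex_of_real r \<in> spectrum a \<Longrightarrow> 0 \<le> r"
  using assms by (force simp: pos_cone_def)+

text \<open>
  The norm of \<open>t - a\<close> is attained, up to sign, in its spectrum, which lies in \<open>{0..t}\<close> since that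
  of \<open>a\<close> does.
\<close>

lemma pos_cone_norm_le:
  fixes a :: "'a::cstar_algebra"
  assumes a: "a \<in> pos_cone" and t: "norm a \<le> t"
  shows "norm (t *\<^sub>R 1 - a) \<le> t"
proof -
  let ?b = "t *\<^sub>R 1 - a"
  have "self_adjoint ?b" using pos_coneD(1)[OF a] by (simp add: self_adjoint_simps)
  from norm_in_spectrum[OF this] show ?thesis
  proof
    assume "complex_of_real (norm ?b) \<in> spectrum ?b"
    then have "complex_of_real (t - norm ?b) \<in> spectrum a" by (simp only: spectrum_reflect)
    from pos_coneD(2)[OF a this] show ?thesis by simp
  next
    assume "complex_of_real (- norm ?b) \<in> spectrum ?b"
    then have "complex_of_real (t + norm ?b) \<in> spectrum a" by (simp only: spectrum_reflect) simp
    from spectrum_norm_bound[OF this] have "\<bar>t + norm ?b\<bar> \<le> t" using t by (simp only: norm_of_real)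
    then show ?thesis using norm_ge_zero[of ?b] by linarith
  qed
qed

lemma pos_cone_iff:
  "a \<in> pos_cone \<longleftrightarrow> self_adjoint a \<and> norm (norm a *\<^sub>R 1 - a) \<le> norm a"
  using pos_cone_norm_le pos_cone_if_norm_le pos_coneD(1) by blast

lemma zero_in_pos_cone: "0 \<in> pos_cone"
  by (simp add: pos_cone_iff self_adjoint_simps)

lemma pos_cone_add:
  assumes "a \<in> pos_cone" "b \<in> pos_cone"
  shows "a + b \<in> pos_cone"
proof (rule pos_cone_if_norm_le)
  show "self_adjoint (a + b)" using assms pos_coneD(1) self_adjoint_simps(3) by blast
  have "(norm a + norm b) *\<^sub>R 1 - (a + b) = (norm a *\<^sub>R 1 - a) + (norm b *\<^sub>R 1 - b)"
    by (simp add: algebra_simps)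
  also have "norm \<dots> \<le> norm a + norm b"
    using assms by (intro norm_triangle_mono) (simp_all add: pos_cone_iff)
  finally show "norm ((norm a + norm b) *\<^sub>R 1 - (a + b)) \<le> norm a + norm b" .
qed

lemma pos_cone_scaleR:
  assumes "a \<in> pos_cone" "0 \<le> r"
  shows "r *\<^sub>R a \<in> pos_cone"
proof (rule pos_cone_if_norm_le)
  show "self_adjoint (r *\<^sub>R a)" using assms pos_coneD(1) self_adjoint_simps(5) by blast
  have "(r * norm a) *\<^sub>R 1 - r *\<^sub>R a = r *\<^sub>R (norm a *\<^sub>R 1 - a)"
    by (simp add: algebra_simps)
  then show "norm ((r * norm a) *\<^sub>R 1 - r *\<^sub>R a) \<le> r * norm a"
    using assms by (simp add: pos_cone_iff mult_left_mono)
qed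

lemma pos_cone_limit:
  fixes s :: "nat \<Rightarrow> 'a::cstar_algebra"
  assumes lim: "s \<longlonglongrightarrow> a" and s: "\<And>n. s n \<in> pos_cone"
  shows "a \<in> pos_cone"
proof -
  have "self_adjoint a" using self_adjoint_limit[OF lim] s pos_coneD(1) by blast
  moreover have "norm (norm a *\<^sub>R 1 - a) \<le> norm a"
  proof (rule LIMSEQ_le)
    show "(\<lambda>n. norm (norm (s n) *\<^sub>R 1 - s n)) \<longlonglongrightarrow> norm (norm a *\<^sub>R 1 - a)"
      by (intro tendsto_intros lim)
    show "(\<lambda>n. norm (s n)) \<longlonglongrightarrow> norm a" by (intro tendsto_intros lim)
    show "\<exists>N. \<forall>n\<ge>N. norm (norm (s n) *\<^sub>R 1 - s n) \<le> norm (s n)"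
      using s by (simp add: pos_cone_iff)
  qed
  ultimately show ?thesis by (simp add: pos_cone_iff)
qed

section \<open>The order induced by the cone\<close>

lemma zero_cstar_le_iff: "0 \<preceq> a \<longleftrightarrow> a \<in> pos_cone"
  using pos_coneD(1) by (auto simp: cstar_le_def self_adjoint_simps)

lemma cstar_le_refl: "self_adjoint a \<Longrightarrow> a \<preceq> a"
  by (simp add: cstar_le_def zero_in_pos_cone)

lemma cstar_le_trans [trans]: "a \<preceq> b \<Longrightarrow> b \<preceq> c \<Longrightarrow> a \<preceq> c"
  using pos_cone_add[of "b - a" "c - b"] by (auto simp: cstar_le_def)

lemma cstar_le_add: "a \<preceq> b \<Longrightarrow> a' \<preceq> b' \<Longrightarrow> a + a' \<preceq> b + b'"
  using pos_cone_add[of "b - a" "b' - a'"]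
  by (auto simp: cstar_le_def self_adjoint_simps algebra_simps)

lemma cstar_le_scaleR: "a \<preceq> b \<Longrightarrow> 0 \<le> r \<Longrightarrow> r *\<^sub>R a \<preceq> r *\<^sub>R b"
  using pos_cone_scaleR[of "b - a" r]
  by (auto simp: cstar_le_def self_adjoint_simps scaleR_diff_right)

lemma cstar_le_scaleR_left: "a \<in> pos_cone \<Longrightarrow> r \<le> s \<Longrightarrow> r *\<^sub>R a \<preceq> s *\<^sub>R a"
  using pos_cone_scaleR[of a "s - r"] pos_coneD(1)[of a]
  by (auto simp: cstar_le_def self_adjoint_simps scaleR_left_diff_distrib)

text \<open>
  By transitivity \<open>norm b - a\<close> is positive, so no point of the spectrum of \<open>a\<close> exceeds \<open>norm b\<close>.
  For positive \<open>a\<close> the number \<open>norm a\<close> itself belongs to that spectrum.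
\<close>

lemma cstar_le_norm:
  fixes a b :: "'a::cstar_algebra"
  assumes a: "a \<in> pos_cone" and ab: "a \<preceq> b"
  shows "norm a \<le> norm b"
proof -
  have "norm b *\<^sub>R 1 - b \<in> pos_cone"
    by (rule pos_cone_if_norm_le[where t="norm b"])
      (use ab in \<open>simp_all add: cstar_le_def self_adjoint_simps\<close>)
  moreover have "b - a \<in> pos_cone" using ab by (simp add: cstar_le_def)
  ultimately have P: "norm b *\<^sub>R 1 - a \<in> pos_cone"
    using pos_cone_add[of "norm b *\<^sub>R 1 - b" "b - a"] by simp
  from norm_in_spectrum[OF pos_coneD(1)[OF a]] show ?thesis
  proof
    assume "complex_of_real (norm a) \<in> spectrum a"
    then have "complex_of_real (norm b - norm a) \<in> spectrum (norm b *\<^sub>R 1 - a)"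
      by (simp only: spectrum_reflect) simp
    from pos_coneD(2)[OF P this] show ?thesis by simp
  next
    assume "complex_of_real (- norm a) \<in> spectrum a"
    from pos_coneD(2)[OF a this] have "norm a = 0" using norm_ge_zero[of a] by linarith
    then show ?thesis by simp
  qed
qed

section \<open>Picard iteration for \<open>(F, \<phi>)\<close>-contractions\<close>

locale F_phi_contraction_system = cstar_metric_space X d
  for X :: "'x set" and d :: "'x \<Rightarrow> 'x \<Rightarrow> 'a::cstar_algebra" +
  fixes \<phi> :: "'x \<Rightarrow> 'a" and F :: "'a \<Rightarrow> 'a \<Rightarrow> 'a \<Rightarrow> 'a" and T :: "'x \<Rightarrow> 'x" and k :: real
  assumes \<phi>_pos: "x \<in> X \<Longrightarrow> \<phi> x \<in> pos_cone"
    and F_class: "F \<in> class_F"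
    and T_closed: "x \<in> X \<Longrightarrow> T x \<in> X"
    and contraction: "F_phi_contraction_with k X d F \<phi> T"
begin

lemma k: "0 < k" "k < 1"
  using contraction by (auto simp: F_phi_contraction_with_def)

lemma contract:
  "x \<in> X \<Longrightarrow> y \<in> X \<Longrightarrow> F (d (T x) (T y)) (\<phi> (T x)) (\<phi> (T y)) \<preceq> k *\<^sub>R F (d x y) (\<phi> x) (\<phi> y)"
  using contraction by (auto simp: F_phi_contraction_with_def)

lemma d_pos: "x \<in> X \<Longrightarrow> y \<in> X \<Longrightarrow> d x y \<in> pos_cone"
  using nonneg zero_cstar_le_iff by blast

lemma F_pos: "x \<in> X \<Longrightarrow> y \<in> X \<Longrightarrow> F (d x y) (\<phi> x) (\<phi> y) \<in> pos_cone"
  using F_class d_pos \<phi>_pos by (auto simp: class_F_def)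

lemma le_F:
  assumes "x \<in> X" "y \<in> X"
  shows "d x y \<preceq> F (d x y) (\<phi> x) (\<phi> y)" "\<phi> x \<preceq> F (d x y) (\<phi> x) (\<phi> y)"
  using assms F_class d_pos \<phi>_pos by (auto simp: class_F_def)

lemma norm_triangle_d:
  assumes "x \<in> X" "y \<in> X" "z \<in> X"
  shows "norm (d x y) \<le> norm (d x z) + norm (d z y)"
  using cstar_le_norm[OF d_pos triangle] assms norm_triangle_ineq order_trans by meson

lemma iterate_closed: "x \<in> X \<Longrightarrow> (T ^^ n) x \<in> X"
  by (induction n) (simp_all add: T_closed)

text \<open>
  At fixed points the contraction compares the value of \<open>F\<close> with \<open>k\<close> times itself. Taking \<open>y = x\<close>
  shows that \<open>\<phi>\<close> vanishes at every fixed point, and distinct fixed points are excluded by \<open>d x y = 0\<close>.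
\<close>

lemma d_and_phi_vanish_at_fixed_points:
  assumes "x \<in> X" "y \<in> X" "T x = x" "T y = y"
  shows "d x y = 0" "\<phi> x = 0"
proof -
  let ?f = "F (d x y) (\<phi> x) (\<phi> y)"
  have "norm ?f \<le> norm (k *\<^sub>R ?f)"
    using contract[of x y] assms F_pos by (intro cstar_le_norm) auto
  then have "(1 - k) * norm ?f \<le> 0" using k by (simp add: algebra_simps)
  then have "?f = 0" using k by (simp add: mult_le_0_iff)
  with le_F[of x y] have "norm (d x y) \<le> 0" "norm (\<phi> x) \<le> 0"
    using cstar_le_norm[OF d_pos, of x y 0] cstar_le_norm[OF \<phi>_pos, of x 0] assms by auto
  then show "d x y = 0" "\<phi> x = 0" by simp_all
qed

text \<open>
  Since \<open>F\<close> dominates its first two arguments, this one quantity bounds both the step from \<open>x\<close> to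
  \<open>T x\<close> and \<open>\<phi> (T x)\<close>; the order of \<open>T x\<close> and \<open>x\<close> is the one of the error estimate.
\<close>

definition gap :: "'x \<Rightarrow> 'a" where
  "gap x = F (d (T x) x) (\<phi> (T x)) (\<phi> x)"

lemma gap_pos: "x \<in> X \<Longrightarrow> gap x \<in> pos_cone"
  by (simp add: gap_def F_pos T_closed)

lemma gap_iterate:
  assumes "x \<in> X"
  shows "gap ((T ^^ n) x) \<preceq> k ^ n *\<^sub>R gap x"
proof (induction n)
  case 0
  then show ?case using pos_coneD(1)[OF gap_pos[OF assms]] by (simp add: cstar_le_refl)
next
  case (Suc n)
  have "gap ((T ^^ Suc n) x) \<preceq> k *\<^sub>R gap ((T ^^ n) x)"
    using contract[of "T ((T ^^ n) x)" "(T ^^ n) x"] iterate_closed[OF assms, of n]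
    by (simp add: gap_def T_closed)
  also have "k *\<^sub>R gap ((T ^^ n) x) \<preceq> k *\<^sub>R (k ^ n *\<^sub>R gap x)"
    using Suc k by (intro cstar_le_scaleR) auto
  finally show ?case by simp
qed

text \<open>
  The triangle inequality bounds the distance by a partial geometric sum of multiples of \<open>gap x\<close>. As
  \<open>gap x\<close> is positive, the scalar coefficient may be enlarged to the full sum.
\<close>

lemma d_iterates:
  assumes x: "x \<in> X"
  shows "d ((T ^^ n) x) ((T ^^ (n + j)) x) \<preceq> (k ^ n / (1 - k)) *\<^sub>R gap x"
proof -
  note [simp] = iterate_closed[OF x]
  have "d ((T ^^ n) x) ((T ^^ (n + j)) x) \<preceq> (\<Sum>i<j. k ^ (n + i)) *\<^sub>R gap x"
  proof (induction j)
    case 0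
    have "d ((T ^^ n) x) ((T ^^ n) x) = 0" by (simp add: zero_iff)
    then show ?case by (simp add: cstar_le_refl self_adjoint_simps)
  next
    case (Suc j)
    let ?y = "(T ^^ (n + j)) x"
    have "d ?y (T ?y) \<preceq> gap ?y"
      using le_F(1)[of "T ?y" ?y] by (simp add: gap_def commute T_closed)
    also have "gap ?y \<preceq> k ^ (n + j) *\<^sub>R gap x" by (rule gap_iterate[OF x])
    finally have step: "d ?y (T ?y) \<preceq> k ^ (n + j) *\<^sub>R gap x" .
    have "d ((T ^^ n) x) (T ?y) \<preceq> d ((T ^^ n) x) ?y + d ?y (T ?y)"
      by (rule triangle) (simp_all add: T_closed)
    also have "\<dots> \<preceq> (\<Sum>i<j. k ^ (n + i)) *\<^sub>R gap x + k ^ (n + j) *\<^sub>R gap x"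
      using Suc step by (rule cstar_le_add)
    finally show ?case by (simp add: scaleR_left_distrib)
  qed
  also have "(\<Sum>i<j. k ^ (n + i)) *\<^sub>R gap x \<preceq> (k ^ n / (1 - k)) *\<^sub>R gap x"
  proof (rule cstar_le_scaleR_left[OF gap_pos[OF x]])
    have "(\<Sum>i<j. k ^ (n + i)) = k ^ n * ((1 - k ^ j) / (1 - k))"
      using k by (simp add: power_add sum_distrib_left[symmetric] sum_gp_strict)
    also have "\<dots> \<le> k ^ n * (1 / (1 - k))"
      using k by (intro mult_left_mono divide_right_mono) auto
    finally show "(\<Sum>i<j. k ^ (n + i)) \<le> k ^ n / (1 - k)" by simp
  qed
  finally show ?thesis .
qed

lemma powers_of_k_tendsto_zero: "(\<lambda>n. k ^ n * c) \<longlonglongrightarrow> 0"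
  using k by (intro tendsto_mult_left_zero LIMSEQ_power_zero) simp

lemma iterates_Cauchy:
  assumes x: "x \<in> X"
  shows "cstar_Cauchy d (\<lambda>n. (T ^^ n) x)"
  unfolding cstar_Cauchy_def
proof (intro allI impI)
  fix e :: real assume e: "0 < e"
  define c where "c = norm (gap x) / (1 - k)"
  obtain N where N: "\<And>n. n \<ge> N \<Longrightarrow> k ^ n * c < e"
    using order_tendstoD(2)[OF powers_of_k_tendsto_zero e, of c]
    by (auto simp: eventually_sequentially)
  have ordered: "norm (d ((T ^^ n) x) ((T ^^ m) x)) < e" if "n \<ge> N" "n \<le> m" for n m
  proof -
    have "norm (d ((T ^^ n) x) ((T ^^ m) x)) \<le> norm ((k ^ n / (1 - k)) *\<^sub>R gap x)"
      using d_iterates[OF x, of n "m - n"] that iterate_closed[OF x]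
      by (intro cstar_le_norm d_pos) auto
    also have "\<dots> = k ^ n * c" using k by (simp add: c_def)
    also have "\<dots> < e" using N that by blast
    finally show ?thesis .
  qed
  have "norm (d ((T ^^ n) x) ((T ^^ m) x)) < e" if "n \<ge> N" "m \<ge> N" for n m
    using ordered[of n m] ordered[of m n] that commute[OF iterate_closed[OF x] iterate_closed[OF x]]
    by (metis nat_le_linear)
  then show "\<exists>N. \<forall>n\<ge>N. \<forall>m\<ge>N. norm (d ((T ^^ n) x) ((T ^^ m) x)) < e" by blast
qed

lemma \<phi>_iterates:
  assumes x: "x \<in> X"
  shows "(\<lambda>n. norm (\<phi> ((T ^^ n) x))) \<longlonglongrightarrow> 0"
proof -
  have "norm (\<phi> (T ((T ^^ n) x))) \<le> k ^ n * norm (gap x)" for n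
  proof -
    note y = iterate_closed[OF x, of n]
    have "\<phi> (T ((T ^^ n) x)) \<preceq> gap ((T ^^ n) x)"
      using le_F(2)[OF T_closed[OF y] y] by (simp add: gap_def)
    from cstar_le_norm[OF \<phi>_pos[OF T_closed[OF y]] cstar_le_trans[OF this gap_iterate[OF x]]]
    show ?thesis using k by simp
  qed
  then have "(\<lambda>n. norm (\<phi> (T ((T ^^ n) x)))) \<longlonglongrightarrow> 0"
    by (intro tendsto_sandwich[OF _ _ tendsto_const powers_of_k_tendsto_zero[of "norm (gap x)"]])
      auto
  then show ?thesis using filterlim_sequentially_Suc[of "\<lambda>n. norm (\<phi> ((T ^^ n) x))"] by simp
qed

text \<open>
  Because \<open>\<phi> z = 0\<close> is known first, all three arguments of \<open>F\<close> in the contraction between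
  \<open>T\<^sup>n x\<close> and \<open>z\<close> tend to zero; so \<open>T\<^sup>n\<^sup>+\<^sup>1 x\<close> approaches \<open>T z\<close> as well as \<open>z\<close>.
\<close>

lemma limit_is_fixed_zero:
  assumes x: "x \<in> X" and z: "z \<in> X" and lsc: "cstar_lsc X d \<phi>"
    and conv: "cstar_converges d (\<lambda>n. (T ^^ n) x) z"
  shows "\<phi> z = 0" "T z = z"
proof -
  let ?s = "\<lambda>n. (T ^^ n) x"
  note s = iterate_closed[OF x]
  have "range ?s \<subseteq> X" using s by blast
  then have "ereal (norm (\<phi> z)) \<le> liminf (\<lambda>n. ereal (norm (\<phi> (?s n))))"
    using lsc z conv unfolding cstar_lsc_def by blast
  also have "\<dots> = ereal 0"
    by (intro lim_imp_Liminf sequentially_bot tendsto_ereal \<phi>_iterates[OF x])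
  finally show \<phi>z: "\<phi> z = 0" by simp
  have d0: "(\<lambda>n. d (?s n) z) \<longlonglongrightarrow> 0"
    using conv unfolding cstar_converges_def by (rule tendsto_norm_zero_cancel)
  have \<phi>0: "(\<lambda>n. \<phi> (?s n)) \<longlonglongrightarrow> 0" using \<phi>_iterates[OF x] by (rule tendsto_norm_zero_cancel)
  have "(\<lambda>n. F (d (?s n) z) (\<phi> (?s n)) (\<phi> z)) \<longlonglongrightarrow> F 0 0 0"
  proof -
    have "continuous_on (pos_cone \<times> pos_cone \<times> pos_cone) (\<lambda>(x, y, z). F x y z)"
      using F_class by (simp add: class_F_def)
    moreover have "(\<lambda>n. (d (?s n) z, \<phi> (?s n), \<phi> z)) \<longlonglongrightarrow> (0, 0, 0)"
      unfolding \<phi>z by (intro tendsto_Pair d0 \<phi>0 tendsto_const)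
    ultimately show ?thesis
      using continuous_on_tendsto_compose
        [of "pos_cone \<times> pos_cone \<times> pos_cone" "\<lambda>(x, y, z). F x y z"
          "\<lambda>n. (d (?s n) z, \<phi> (?s n), \<phi> z)" "(0, 0, 0)" sequentially]
      by (auto simp: zero_in_pos_cone d_pos s z \<phi>_pos)
  qed
  then have F0: "(\<lambda>n. norm (F (d (?s n) z) (\<phi> (?s n)) (\<phi> z))) \<longlonglongrightarrow> 0"
    using F_class by (intro tendsto_norm_zero) (simp add: class_F_def)
  have bound: "norm (d z (T z)) \<le> norm (d (?s (Suc n)) z)
      + k * norm (F (d (?s n) z) (\<phi> (?s n)) (\<phi> z))" for n
  proof -
    have "d (?s (Suc n)) (T z) \<preceq> k *\<^sub>R F (d (?s n) z) (\<phi> (?s n)) (\<phi> z)"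
      using cstar_le_trans[OF le_F(1) contract] s[of n] z by (simp add: T_closed)
    from cstar_le_norm[OF d_pos this]
    have "norm (d (?s (Suc n)) (T z)) \<le> k * norm (F (d (?s n) z) (\<phi> (?s n)) (\<phi> z))"
      using s[of "Suc n"] T_closed z k by simp
    moreover have "norm (d z (T z)) \<le> norm (d (?s (Suc n)) z) + norm (d (?s (Suc n)) (T z))"
      using norm_triangle_d[of z "T z" "?s (Suc n)"] commute[of z "?s (Suc n)"] s[of "Suc n"] z
      by (simp add: T_closed)
    ultimately show ?thesis by simp
  qed
  have "(\<lambda>n. norm (d (?s (Suc n)) z) + k * norm (F (d (?s n) z) (\<phi> (?s n)) (\<phi> z))) \<longlonglongrightarrow> 0 + k * 0"
    by (intro tendsto_intros F0 LIMSEQ_Suc[OF conv[unfolded cstar_converges_def]])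
  then have "norm (d z (T z)) \<le> 0 + k * 0"
    by (rule LIMSEQ_le_const) (use bound in blast)
  then show "T z = z" using zero_iff[of z "T z"] z T_closed by auto
qed

text \<open>
  Passing to the limit in the second argument of \<open>d_iterates\<close>: the remainder \<open>d (T\<^sup>n\<^sup>+\<^sup>j x) z\<close> of
  the triangle inequality tends to zero in norm, and the cone is closed.
\<close>

lemma d_iterate_limit:
  assumes x: "x \<in> X" and z: "z \<in> X" and conv: "cstar_converges d (\<lambda>n. (T ^^ n) x) z"
  shows "d ((T ^^ n) x) z \<preceq> (k ^ n / (1 - k)) *\<^sub>R gap x"
proof -
  let ?b = "(k ^ n / (1 - k)) *\<^sub>R gap x"
  note [simp] = iterate_closed[OF x] z
  have "d ((T ^^ n) x) z \<preceq> ?b + d ((T ^^ (n + j)) x) z" for j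
  proof -
    have "d ((T ^^ n) x) z \<preceq> d ((T ^^ n) x) ((T ^^ (n + j)) x) + d ((T ^^ (n + j)) x) z"
      by (rule triangle) simp_all
    also have "\<dots> \<preceq> ?b + d ((T ^^ (n + j)) x) z"
      using d_iterates[OF x] pos_coneD(1)[OF d_pos] by (intro cstar_le_add cstar_le_refl) auto
    finally show ?thesis .
  qed
  then have "?b + d ((T ^^ (n + j)) x) z - d ((T ^^ n) x) z \<in> pos_cone" for j
    by (simp add: cstar_le_def)
  moreover have "(\<lambda>j. ?b + d ((T ^^ (n + j)) x) z - d ((T ^^ n) x) z)
      \<longlonglongrightarrow> ?b + 0 - d ((T ^^ n) x) z"
  proof -
    have "(\<lambda>m. d ((T ^^ m) x) z) \<longlonglongrightarrow> 0"
      using conv unfolding cstar_converges_def by (rule tendsto_norm_zero_cancel)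
    then have "(\<lambda>j. d ((T ^^ (n + j)) x) z) \<longlonglongrightarrow> 0"
      using LIMSEQ_ignore_initial_segment[of _ 0 n] by (simp add: add.commute)
    then show ?thesis by (intro tendsto_intros)
  qed
  ultimately have "?b - d ((T ^^ n) x) z \<in> pos_cone" using pos_cone_limit by force
  then show ?thesis
    using pos_coneD(1)[OF d_pos] pos_coneD(1)[OF gap_pos[OF x]]
    by (simp add: cstar_le_def self_adjoint_simps)
qed

end

theorem theorem3p7:
  fixes X :: "'x set"
    and d :: "'x \<Rightarrow> 'x \<Rightarrow> 'a::cstar_algebra"
    and \<phi> :: "'x \<Rightarrow> 'a"
    and F :: "'a \<Rightarrow> 'a \<Rightarrow> 'a \<Rightarrow> 'a"
    and T :: "'x \<Rightarrow> 'x"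
    and k :: real
  assumes "cstar_metric_space X d"
    and "cstar_complete X d"
    and "\<phi> \<in> X \<rightarrow> pos_cone"
    and "F \<in> class_F"
    and "T \<in> X \<rightarrow> X"
    and "cstar_lsc X d \<phi>"
    and "F_phi_contraction_with k X d F \<phi> T"
  shows "fixed_points X T \<subseteq> zero_set X \<phi>
    \<and> phi_Picard_operator X d \<phi> T
    \<and> (\<exists>z. fixed_points X T \<inter> zero_set X \<phi> = {z} \<and> fixed_points X T = {z} \<and>
        (\<forall>x\<in>X. \<forall>n::nat.
          d ((T ^^ n) x) z \<preceq> (k ^ n / (1 - k)) *\<^sub>R F (d (T x) x) (\<phi> (T x)) (\<phi> x)))"
proof -
  interpret F_phi_contraction_system X d \<phi> F T k
    using assms by (auto simp: F_phi_contraction_system_def F_phi_contraction_system_axioms_def)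
  have limit: "\<exists>z\<in>X. cstar_converges d (\<lambda>n. (T ^^ n) x) z" if "x \<in> X" for x
  proof -
    have "range (\<lambda>n. (T ^^ n) x) \<subseteq> X" using iterate_closed[OF that] by blast
    then show ?thesis
      using assms(2) iterates_Cauchy[OF that] unfolding cstar_complete_def by blast
  qed
  have fixed_zero: "fixed_points X T \<subseteq> zero_set X \<phi>"
    using d_and_phi_vanish_at_fixed_points(2) by (auto simp: fixed_points_def zero_set_def)
  obtain x0 where x0: "x0 \<in> X" using nonempty by blast
  obtain z where z: "z \<in> X" and z_lim: "cstar_converges d (\<lambda>n. (T ^^ n) x0) z"
    using limit[OF x0] by blast
  note Tz = limit_is_fixed_zero(2)[OF x0 z assms(6) z_lim]
  have unique: "y = z" if "y \<in> X" "T y = y" for y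
    using d_and_phi_vanish_at_fixed_points(1)[of y z] that z Tz zero_iff by blast
  then have fixed: "fixed_points X T = {z}" using z Tz unfolding fixed_points_def by blast
  have conv: "cstar_converges d (\<lambda>n. (T ^^ n) x) z" if x: "x \<in> X" for x
    using limit[OF x] limit_is_fixed_zero(2)[OF x _ assms(6)] unique by blast
  have both: "fixed_points X T \<inter> zero_set X \<phi> = {z}" using fixed fixed_zero by blast
  then have "phi_Picard_operator X d \<phi> T"
    using z conv unfolding phi_Picard_operator_def by blast
  moreover have "\<forall>x\<in>X. \<forall>n::nat.
      d ((T ^^ n) x) z \<preceq> (k ^ n / (1 - k)) *\<^sub>R F (d (T x) x) (\<phi> (T x)) (\<phi> x)"
    using d_iterate_limit[OF _ z conv] by (simp add: gap_def)
  ultimately show ?thesis using fixed_zero both fixed by blast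
qed

end
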